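(* Let $0<\alpha<1$, let $\Omega=(a,b)$, and let $\kappa$ satisfy $c_0\le\kappa(x)\le c_1$ on $\Omega$ for some positive constants $c_0,c_1$. Then for $1\le n\le P$ the finite difference solution $U^n$ of the left-sided scheme $$\kappa^{n-1/2}\,\big({}_aI_x^{1-\alpha}\,\delta U\big)(x_n)-\kappa^{n+1/2}\,\big({}_aI_x^{1-\alpha}\,\delta U\big)(x_{n+1})=h^2 f^n,\qquad n=1,\dots,P-1,$$ with $U^0=U^P=0$, exists and is unique.
   Context: Uniform mesh: $P\ge 2$ is an integer, $h=(b-a)/P$, $x_n=a+nh$ for $0\le n\le P$, $I_n=(x_{n-1},x_n)$, $x_{n+1/2}=(x_n+x_{n+1})/2$, $\kappa^{n+1/2}=\kappa(x_{n+1/2})$, $f^n=f(x_n)$ where $f$ is a given source function on $\Omega$. For nodal values $U^0,\dots,U^P$, the backward difference $\delta U$ is the piecewise constant function $\delta U(x)=\delta U^n:=U^n-U^{n-1}$ for $x\in I_n$. The left-sided Riemann–Liouville fractional integral is ${}_aI_x^{1-\alpha}v(x)=\int_a^x\omega_{1-\alpha}(x-z)v(z)\,dz$ with $\omega_{1-\alpha}(x)=x^{-\alpha}/\Gamma(1-\alpha)$. Hence $$\big({}_aI_x^{1-\alpha}\delta U\big)(x_n)=\sum_{j=1}^n \delta U^j\int_{I_j}\omega_{1-\alpha}(x_n-s)\,ds=\omega_{2-\alpha}(h)\sum_{j=1}^n w_{n,j}\,\delta U^j,$$ where $\omega_{2-\alpha}(h)=h^{1-\alpha}/\Gamma(2-\alpha)$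 and $w_{n,j}=(n+1-j)^{1-\alpha}-(n-j)^{1-\alpha}$ for $n\ge j\ge1$. The scheme approximates the problem $-\partial_x(\kappa\,{}_aD_x^{\alpha}u)=f$ on $\Omega$ with $u(a)=u(b)=0$. *)

theory Defs
  imports "HOL-Analysis.Analysis"
begin

definition mesh_step :: "real \<Rightarrow> real \<Rightarrow> nat \<Rightarrow> real" where
  "mesh_step a b P = (b - a) / real P"

definition mesh_node :: "real \<Rightarrow> real \<Rightarrow> nat \<Rightarrow> nat \<Rightarrow> real" where
  "mesh_node a b P n = a + real n * mesh_step a b P"

text \<open>The half-integer node \<open>x\<^sub>n\<^sub>+\<^sub>1\<^sub>/\<^sub>2\<close> is indexed by the integer \<open>n\<close> to its left;
  hence \<open>x\<^sub>n\<^sub>-\<^sub>1\<^sub>/\<^sub>2\<close> is \<open>mesh_mid a b P (n - 1)\<close> for \<open>n \<ge> 1\<close>.\<close>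

definition mesh_mid :: "real \<Rightarrow> real \<Rightarrow> nat \<Rightarrow> nat \<Rightarrow> real" where
  "mesh_mid a b P n = (mesh_node a b P n + mesh_node a b P (n + 1)) / 2"

text \<open>The piecewise constant function equal to \<open>U n - U (n - 1)\<close> on the open cell \<open>I\<^sub>n\<close>.
  Its value at the nodes is immaterial (a null set) and is zero here.\<close>

definition backward_diff :: "real \<Rightarrow> real \<Rightarrow> nat \<Rightarrow> (nat \<Rightarrow> real) \<Rightarrow> real \<Rightarrow> real" where
  "backward_diff a b P U x =
     (\<Sum>n=1..P. (U n - U (n - 1)) *
        indicator {mesh_node a b P (n - 1)<..<mesh_node a b P n} x)"

text \<open>The kernel \<open>\<omega>\<^sub>\<beta>\<close>, used for positive arguments only.\<close>

definition frac_kernel :: "real \<Rightarrow> real \<Rightarrow> real" where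
  "frac_kernel \<beta> x = x powr (\<beta> - 1) / Gamma \<beta>"

definition RL_integral :: "real \<Rightarrow> real \<Rightarrow> (real \<Rightarrow> real) \<Rightarrow> real \<Rightarrow> real" where
  "RL_integral a \<beta> v x = (LBINT z:{a<..<x}. frac_kernel \<beta> (x - z) * v z)"

definition left_fd_solution ::
  "real \<Rightarrow> real \<Rightarrow> nat \<Rightarrow> real \<Rightarrow> (real \<Rightarrow> real) \<Rightarrow> (real \<Rightarrow> real) \<Rightarrow> (nat \<Rightarrow> real) \<Rightarrow> bool" where
  "left_fd_solution a b P \<alpha> \<kappa> f U \<longleftrightarrow>
     U 0 = 0 \<and> U P = 0 \<and>
     (\<forall>n\<in>{1..P - 1}.
        \<kappa> (mesh_mid a b P (n - 1)) *
          RL_integral a (1 - \<alpha>) (backward_diff a b P U) (mesh_node a b P n)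
        - \<kappa> (mesh_mid a b P n) *
          RL_integral a (1 - \<alpha>) (backward_diff a b P U) (mesh_node a b P (n + 1))
        = (mesh_step a b P)\<^sup>2 * f (mesh_node a b P n))"

end

theory Submission
  imports Defs
begin

text \<open>Why the scheme has exactly one solution.

  At a mesh node the fractional integral of the piecewise constant \<open>\<delta>U\<close> is, up to a positive
  constant \<open>c\<close>, the finite convolution \<open>L U n = (\<Sum>j=1..n. g (n - j) * (U j - U (j - 1)))\<close> of the
  differences of \<open>U\<close> with \<open>g i = (i + 1)\<^sup>\<beta> - i\<^sup>\<beta>\<close>, \<open>\<beta> = 1 - \<alpha>\<close> (lemma
  \<open>RL_integral_backward_diff\<close>). So the scheme prescribes the steps of the discrete flux
  \<open>q n = k (n - 1) * L U n\<close>, where \<open>k n\<close> is \<open>c\<close> times the value of \<open>\<kappa>\<close> halfway between the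
  nodes \<open>n\<close> and \<open>n + 1\<close>. It therefore fixes \<open>q\<close> up to one additive constant \<open>C\<close>. Since
  \<open>g 0 = 1\<close>, the map \<open>L\<close> is triangular with unit diagonal, so \<open>U 0 = 0\<close> and \<open>C\<close> determine
  \<open>U\<close>. The remaining condition \<open>U P = 0\<close> is one affine equation in \<open>C\<close>, and everything rests
  on its slope being nonzero.

  The slope is \<open>B P\<close>, where \<open>L B n = 1 / k (n - 1) > 0\<close> and \<open>B 0 = 0\<close>. Because
  \<open>t \<mapsto> t\<^sup>\<beta>\<close> is concave, \<open>g\<close> decreases. Summation by parts then writes
  \<open>L B n\<close> as \<open>B n\<close> minus a combination of the earlier values of \<open>B\<close> with nonnegative
  coefficients. Hence a nonnegative \<open>L B\<close> forces \<open>B n \<ge> L B n\<close> (lemma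
  \<open>diff_conv_le_if_nonneg\<close>), and in particular \<open>B P > 0\<close>. The same comparison shows that a
  solution with constant flux \<open>C\<close> ends at a value with the sign of \<open>C\<close>, which gives
  uniqueness.\<close>

section \<open>Convolutions of differences with a decreasing sequence\<close>

definition diff_conv :: "(nat \<Rightarrow> real) \<Rightarrow> (nat \<Rightarrow> real) \<Rightarrow> nat \<Rightarrow> real" where
  "diff_conv g U n = (\<Sum>j=1..n. g (n - j) * (U j - U (j - 1)))"

lemma diff_conv_cong:
  assumes "\<And>j. j \<le> n \<Longrightarrow> U j = V j"
  shows "diff_conv g U n = diff_conv g V n"
  unfolding diff_conv_def using assms by (intro sum.cong) auto

lemma diff_conv_add_mult:
  "diff_conv g (\<lambda>j. U j + t * V j) n = diff_conv g U n + t * diff_conv g V n"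
  unfolding diff_conv_def by (simp add: sum_distrib_left algebra_simps sum.distrib sum_subtractf)

text \<open>Summation by parts moves the differences from \<open>U\<close> to \<open>g\<close>; the boundary term at
  \<open>0\<close> vanishes with \<open>U 0\<close>. In this form the signs of the off-diagonal coefficients can be read
  off from the monotonicity of \<open>g\<close>.\<close>

lemma diff_conv_by_parts:
  assumes "U 0 = 0" "1 \<le> n"
  shows "diff_conv g U n = g 0 * U n - (\<Sum>j=1..<n. (g (n - Suc j) - g (n - j)) * U j)"
proof -
  have "diff_conv g U n = (\<Sum>j=1..n. g (n - j) * U j) - (\<Sum>j=1..n. g (n - j) * U (j - 1))"
    unfolding diff_conv_def by (simp add: algebra_simps sum_subtractf)
  also have "(\<Sum>j=1..n. g (n - j) * U j) = g 0 * U n + (\<Sum>j=1..<n. g (n - j) * U j)"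
    using assms(2) by (simp add: sum.last_plus add.commute)
  also have "(\<Sum>j=1..n. g (n - j) * U (j - 1)) = (\<Sum>j=0..<n. g (n - Suc j) * U j)"
    by (rule sum.reindex_bij_witness[of _ Suc "\<lambda>j. j - 1"]) auto
  also have "\<dots> = (\<Sum>j=1..<n. g (n - Suc j) * U j)"
    using assms by (simp add: sum.atLeast_Suc_lessThan)
  finally show ?thesis by (simp add: algebra_simps sum_subtractf)
qed

text \<open>A discrete comparison principle. By \<open>diff_conv_by_parts\<close>, \<open>U n\<close> is
  \<open>diff_conv g U n\<close> plus a combination of \<open>U 1, \<dots>, U (n - 1)\<close> whose coefficients are decrements of
  \<open>g\<close>, hence nonnegative; the earlier values of \<open>U\<close> are nonnegative by induction.\<close>

lemma diff_conv_le_if_nonneg: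
  assumes g0: "g 0 = 1" and dec: "decseq g" and U0: "U 0 = 0"
    and nonneg: "\<And>m. \<lbrakk>1 \<le> m; m \<le> N\<rbrakk> \<Longrightarrow> 0 \<le> diff_conv g U m"
    and "1 \<le> n" "n \<le> N"
  shows "diff_conv g U n \<le> U n"
  using \<open>1 \<le> n\<close> \<open>n \<le> N\<close>
proof (induction n rule: less_induct)
  case (less n)
  have "0 \<le> (g (n - Suc j) - g (n - j)) * U j" if "j \<in> {1..<n}" for j
  proof -
    have "g (n - j) \<le> g (n - Suc j)" by (rule decseqD[OF dec]) simp
    moreover have "0 \<le> U j" 
    proof -
      have j: "j < n" "1 \<le> j" "j \<le> N" using that less.prems by auto
      from nonneg[OF j(2,3)] less.IH[OF j] show ?thesis by (rule order_trans)
    qed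
    ultimately show ?thesis by simp
  qed
  then have "0 \<le> (\<Sum>j=1..<n. (g (n - Suc j) - g (n - j)) * U j)" by (rule sum_nonneg)
  then show ?case using diff_conv_by_parts[of U n g] U0 less.prems(1) g0 by simp
qed

text \<open>Forward substitution: the coefficient of \<open>U n\<close> in \<open>diff_conv g U n\<close> is \<open>g 0 = 1\<close>, so each
  new value can be chosen to match the prescribed one.\<close>

lemma diff_conv_surj:
  assumes "g 0 = 1"
  shows "\<exists>U. U 0 = 0 \<and> (\<forall>n\<in>{1..N}. diff_conv g U n = y n)"
proof (induction N)
  case 0
  show ?case by (intro exI[of _ "\<lambda>_. 0"]) simp
next
  case (Suc N)
  then obtain U where U: "U 0 = 0" "\<And>n. n \<in> {1..N} \<Longrightarrow> diff_conv g U n = y n" by blast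
  define r where "r = (\<Sum>j=1..<Suc N. (g (Suc N - Suc j) - g (Suc N - j)) * U j)"
  define V where "V = U(Suc N := y (Suc N) + r)"
  have "diff_conv g V n = y n" if "n \<in> {1..N}" for n
    using diff_conv_cong[of n V U g] U(2)[OF that] that by (simp add: V_def)
  moreover have "diff_conv g V (Suc N) = y (Suc N)"
  proof -
    have "(\<Sum>j=1..<Suc N. (g (Suc N - Suc j) - g (Suc N - j)) * V j) = r"
      unfolding r_def V_def by (intro sum.cong) auto
    then show ?thesis
      using diff_conv_by_parts[of V "Suc N" g] U(1) assms by (simp add: V_def)
  qed
  moreover have "V 0 = 0" using U(1) by (simp add: V_def)
  ultimately show ?case by (metis atLeastAtMost_iff le_Suc_eq)
qed

section \<open>Weights of the discretized fractional integral\<close>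

text \<open>The numbers \<open>w\<^sub>n\<^sub>,\<^sub>j\<close> of the scheme are \<open>L1_weight (1 - \<alpha>) (n - j)\<close>. They are the weights of
  the classical L1 formula for fractional derivatives.\<close>

definition L1_weight :: "real \<Rightarrow> nat \<Rightarrow> real" where
  "L1_weight \<beta> k = real (Suc k) powr \<beta> - real k powr \<beta>"

lemma L1_weight_0: "L1_weight \<beta> 0 = 1"
  by (simp add: L1_weight_def)

text \<open>A weight is the slope of a chord of \<open>t \<mapsto> t powr \<beta>\<close> over an interval of length one. The
  mean value theorem applies even to the interval starting at \<open>0\<close>, where the function is continuous
  but not differentiable when \<open>\<beta> < 1\<close>.\<close>

lemma L1_weight_MVT:
  assumes "0 < \<beta>"
  obtains \<xi> where "real k < \<xi>" "\<xi> < real k + 1" "L1_weight \<beta> k = \<beta> * \<xi> powr (\<beta> - 1)"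
proof -
  have "\<exists>l z. real k < z \<and> z < real k + 1 \<and> DERIV (\<lambda>x. x powr \<beta>) z :> l \<and>
      (real k + 1) powr \<beta> - real k powr \<beta> = (real k + 1 - real k) * l"
  proof (rule MVT)
    show "continuous_on {real k..real k + 1} (\<lambda>x. x powr \<beta>)"
      using assms by (intro continuous_on_powr' continuous_intros) auto
  next
    fix x assume "real k < x"
    then show "(\<lambda>x. x powr \<beta>) differentiable (at x)"
      using has_real_derivative_powr[of x \<beta>] real_differentiable_def by force
  qed simp
  then obtain l z where z: "real k < z" "z < real k + 1" "DERIV (\<lambda>x. x powr \<beta>) z :> l"
      "(real k + 1) powr \<beta> - real k powr \<beta> = l" by auto
  have "0 < z" using z(1) by linarith
  from DERIV_unique[OF z(3) has_real_derivative_powr[OF this]]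
  have "l = \<beta> * z powr (\<beta> - 1)" .
  with z show ?thesis by (intro that[of z]) (simp_all add: L1_weight_def add.commute)
qed

text \<open>Consecutive weights are derivatives of \<open>t powr \<beta>\<close> at points of consecutive intervals,
  and this derivative decreases.\<close>

lemma decseq_L1_weight:
  assumes "0 < \<beta>" "\<beta> < 1"
  shows "decseq (L1_weight \<beta>)"
proof (rule decseq_SucI)
  fix k
  obtain \<xi> where \<xi>: "real k < \<xi>" "\<xi> < real k + 1" "L1_weight \<beta> k = \<beta> * \<xi> powr (\<beta> - 1)"
    using L1_weight_MVT[OF assms(1)] .
  obtain \<eta> where \<eta>: "real (Suc k) < \<eta>" "L1_weight \<beta> (Suc k) = \<beta> * \<eta> powr (\<beta> - 1)"
    using L1_weight_MVT[OF assms(1)] .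
  have "\<eta> powr (\<beta> - 1) \<le> \<xi> powr (\<beta> - 1)"
    using \<xi> \<eta>(1) assms(2) by (intro powr_mono2') auto
  then show "L1_weight \<beta> (Suc k) \<le> L1_weight \<beta> k"
    using \<xi>(3) \<eta>(2) assms(1) by simp
qed

section \<open>The discrete two-point boundary value problem\<close>

lemma const_if_steps_equal:
  fixes q :: "nat \<Rightarrow> real"
  assumes "\<And>n. n \<in> {1..P - 1} \<Longrightarrow> q n = q (n + 1)" "1 \<le> n" "n \<le> P"
  shows "q n = q 1"
  using assms(2,3)
proof (induction n rule: nat_induct_at_least)
  case (Suc n)
  then have "n \<in> {1..P - 1}" by auto
  from assms(1)[OF this] Suc show ?case by simp
qed simp

text \<open>If the constant flux \<open>C\<close> were positive, so would be every \<open>diff_conv g U n\<close>, and the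
  comparison principle would give \<open>U P > 0\<close>. Replacing \<open>U\<close> by \<open>-U\<close> excludes \<open>C < 0\<close>.
  For \<open>C = 0\<close> the comparison principle applied to \<open>U\<close> and \<open>-U\<close> squeezes every value to
  \<open>0\<close>.\<close>

lemma diff_conv_two_point_unique:
  fixes k :: "nat \<Rightarrow> real"
  assumes "g 0 = 1" "decseq g" "1 \<le> P" and k: "\<And>n. n < P \<Longrightarrow> 0 < k n"
    and U: "U 0 = 0" "U P = 0"
    and flux: "\<And>n. n \<in> {1..P} \<Longrightarrow> k (n - 1) * diff_conv g U n = C"
    and "n \<le> P"
  shows "U n = 0"
proof -
  \<comment> \<open>Stated for a general sequence because it is used for both \<open>U\<close> and \<open>-U\<close>.\<close>
  have *: "0 < V P" if V: "V 0 = 0" "\<And>n. n \<in> {1..P} \<Longrightarrow> k (n - 1) * diff_conv g V n = D"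
      and "0 < D" for V D
  proof -
    have pos: "0 < diff_conv g V n" if "n \<in> {1..P}" for n
    proof -
      have "0 < k (n - 1) * diff_conv g V n" using V(2)[OF that] \<open>0 < D\<close> by simp
      moreover have "n - 1 < P" using that by auto
      ultimately show ?thesis using k[of "n - 1"] by (simp add: zero_less_mult_iff)
    qed
    then have "diff_conv g V P \<le> V P"
      using assms V(1) by (intro diff_conv_le_if_nonneg[of g V P P]) (auto intro: less_imp_le)
    then show ?thesis using pos[of P] assms(3) by simp
  qed
  have neg: "diff_conv g (\<lambda>j. - U j) n = - diff_conv g U n" for n
    using diff_conv_add_mult[of g "\<lambda>_. 0" "-1" U n] by (simp add: diff_conv_def)
  have "\<not> 0 < C" using *[of U C] U flux by fastforce
  moreover have "\<not> 0 < - C" using *[of "\<lambda>j. - U j" "- C"] U flux neg by fastforce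
  ultimately have "C = 0" by simp
  have zero: "diff_conv g U m = 0" if "1 \<le> m" "m \<le> P" for m
  proof -
    have "m \<in> {1..P}" "m - 1 < P" using that by auto
    from flux[OF this(1)] k[OF this(2)] \<open>C = 0\<close> show ?thesis by simp
  qed
  show ?thesis
  proof (cases "n = 0")
    case False
    then have n: "1 \<le> n" by simp
    have "diff_conv g U n \<le> U n"
      by (rule diff_conv_le_if_nonneg[of g U P]) (use assms n zero in auto)
    moreover have "diff_conv g (\<lambda>j. - U j) n \<le> - U n"
      by (rule diff_conv_le_if_nonneg[of g "\<lambda>j. - U j" P]) (use assms n neg zero in auto)
    ultimately show ?thesis using neg[of n] zero[OF n \<open>n \<le> P\<close>] by simp
  qed (simp add: U)
qed

text \<open>A shooting argument: \<open>A\<close> has the right flux steps and \<open>B\<close> has constant flux \<open>1\<close>.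
  Then \<open>A + C B\<close> satisfies the equations for every \<open>C\<close>, and since \<open>B P > 0\<close> by comparison, \<open>C\<close>
  can be chosen so that the value at \<open>P\<close> vanishes.\<close>

lemma diff_conv_two_point_exists:
  fixes k F :: "nat \<Rightarrow> real"
  assumes "g 0 = 1" "decseq g" "1 \<le> P" and k: "\<And>n. n < P \<Longrightarrow> 0 < k n"
  shows "\<exists>U. U 0 = 0 \<and> U P = 0 \<and>
    (\<forall>n\<in>{1..P - 1}. k (n - 1) * diff_conv g U n - k n * diff_conv g U (n + 1) = F n)"
proof -
  obtain A where A: "A 0 = 0"
    "\<And>n. n \<in> {1..P} \<Longrightarrow> diff_conv g A n = - (\<Sum>i=1..<n. F i) / k (n - 1)"
    using diff_conv_surj[of g P "\<lambda>n. - (\<Sum>i=1..<n. F i) / k (n - 1)"] assms(1) by blast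
  obtain B where B: "B 0 = 0" "\<And>n. n \<in> {1..P} \<Longrightarrow> diff_conv g B n = 1 / k (n - 1)"
    using diff_conv_surj[of g P "\<lambda>n. 1 / k (n - 1)"] assms(1) by blast
  have posB: "0 < diff_conv g B n" if "n \<in> {1..P}" for n
  proof -
    have "n - 1 < P" using that by auto
    then show ?thesis using B(2)[OF that] k[of "n - 1"] by simp
  qed
  then have "diff_conv g B P \<le> B P"
    using assms B(1) by (intro diff_conv_le_if_nonneg[of g B P P]) (auto intro: less_imp_le)
  then have "0 < B P" using posB[of P] assms(3) by simp
  define C where "C = - A P / B P"
  define U where "U = (\<lambda>j. A j + C * B j)"
  have flux: "k (n - 1) * diff_conv g U n = C - (\<Sum>i=1..<n. F i)" if "n \<in> {1..P}" for n
  proof -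
    have "n - 1 < P" using that by auto
    then have "0 < k (n - 1)" by (rule k)
    then show ?thesis
      using A(2)[OF that] B(2)[OF that]
      unfolding U_def diff_conv_add_mult by (simp add: field_simps)
  qed
  show ?thesis
  proof (intro exI[of _ U] conjI ballI)
    show "U 0 = 0" using A B by (simp add: U_def)
    show "U P = 0" using \<open>0 < B P\<close> by (simp add: U_def C_def)
    show "k (n - 1) * diff_conv g U n - k n * diff_conv g U (n + 1) = F n"
      if "n \<in> {1..P - 1}" for n
    proof -
      have "n \<in> {1..P}" "n + 1 \<in> {1..P}" using that by auto
      from flux[OF this(1)] flux[OF this(2)] that show ?thesis by simp
    qed
  qed
qed

section \<open>The fractional integral at mesh nodes\<close>

text \<open>The primitive \<open>- ((x - z) powr \<beta>) / Gamma (\<beta> + 1)\<close> stays continuous at \<open>z = x\<close>, where the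
  kernel blows up if \<open>\<beta> < 1\<close>. This is why the improper fundamental theorem for nonnegative
  integrands is used: it yields integrability along with the value, also on the cell ending at
  \<open>x\<close>.\<close>

lemma frac_kernel_integral:
  assumes "0 < \<beta>" "p < q" "q \<le> x"
  shows "set_integrable lborel {p<..<q} (\<lambda>z. frac_kernel \<beta> (x - z))"
    and "(LBINT z:{p<..<q}. frac_kernel \<beta> (x - z)) =
      ((x - p) powr \<beta> - (x - q) powr \<beta>) / Gamma (\<beta> + 1)"
proof -
  define c where "c = Gamma \<beta>"
  have c: "0 < c" using assms(1) by (simp add: c_def Gamma_real_pos)
  have Gam: "Gamma (\<beta> + 1) = \<beta> * c"
    unfolding c_def using assms(1) by (auto intro!: Gamma_plus1 dest: nonpos_Ints_nonpos)
  define G where "G = (\<lambda>z. - ((x - z) powr \<beta>) / (\<beta> * c))"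
  have G: "continuous_on {p..q} G"
    unfolding G_def using assms c
    by (intro continuous_on_divide continuous_on_minus continuous_on_powr' continuous_intros) auto
  have lim: "(G \<longlongrightarrow> G y) (at y within {p..q})" if "y \<in> {p..q}" for y
    using G that by (simp add: continuous_on_def)
  have deriv: "DERIV G z :> frac_kernel \<beta> (x - z)" if "p < z" "z < q" for z
    unfolding G_def frac_kernel_def c_def[symmetric] using that assms c
    by (auto intro!: derivative_eq_intros simp: field_simps)
  have cont: "isCont (\<lambda>z. frac_kernel \<beta> (x - z)) z" if "p < z" "z < q" for z
    unfolding frac_kernel_def c_def[symmetric] using that assms c by (intro continuous_intros) auto
  have nonneg: "0 \<le> frac_kernel \<beta> (x - z)" for z
    unfolding frac_kernel_def c_def[symmetric] using c by simp
  have left: "((G \<circ> real_of_ereal) \<longlongrightarrow> G p) (at_right (ereal p))"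
    using lim[of p] assms(2) at_within_Icc_at_right[OF assms(2)]
    by (simp add: ereal_tendsto_simps)
  have right: "((G \<circ> real_of_ereal) \<longlongrightarrow> G q) (at_left (ereal q))"
    using lim[of q] assms(2) at_within_Icc_at_left[OF assms(2)]
    by (simp add: ereal_tendsto_simps)
  note FTC = interval_integral_FTC_nonneg[of "ereal p" "ereal q" G
      "\<lambda>z. frac_kernel \<beta> (x - z)" "G p" "G q"]
  show "set_integrable lborel {p<..<q} (\<lambda>z. frac_kernel \<beta> (x - z))"
    using FTC(1) assms(2) deriv cont nonneg left right by auto
  have "(LBINT z:{p<..<q}. frac_kernel \<beta> (x - z)) = G q - G p"
    using FTC(2) assms(2) deriv cont nonneg left right
    by (auto simp: interval_lebesgue_integral_def)
  then show "(LBINT z:{p<..<q}. frac_kernel \<beta> (x - z)) =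
      ((x - p) powr \<beta> - (x - q) powr \<beta>) / Gamma (\<beta> + 1)"
    by (simp add: G_def Gam diff_divide_distrib)
qed

text \<open>The integral splits over the mesh cells. Cells to the right of the node \<open>n\<close> do not meet the
  domain of integration, and cell \<open>j\<close> spans the distances from \<open>(n - j) h\<close> to
  \<open>(n - j + 1) h\<close> from that node, which produces the weight with index \<open>n - j\<close> and the
  factor \<open>h powr \<beta>\<close>.\<close>

lemma RL_integral_backward_diff:
  assumes "a < b" "0 < \<beta>" "n \<le> P"
  shows "RL_integral a \<beta> (backward_diff a b P U) (mesh_node a b P n) =
    mesh_step a b P powr \<beta> / Gamma (\<beta> + 1) * diff_conv (L1_weight \<beta>) U n"
proof (cases "P = 0")
  case True
  then show ?thesis using assms(3)
    by (simp add: RL_integral_def mesh_node_def diff_conv_def set_lebesgue_integral_def)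
next
  case False
  define h where "h = mesh_step a b P"
  have h: "0 < h" unfolding h_def mesh_step_def using assms(1) False by simp
  define x where "x = mesh_node a b P"
  have x: "x j = a + real j * h" for j by (simp add: x_def mesh_node_def h_def)
  have x_le: "x i \<le> x j \<longleftrightarrow> i \<le> j" for i j using h by (simp add: x)
  define K where "K = (\<lambda>z. frac_kernel \<beta> (x n - z))"
  define I where "I = (\<lambda>j. {x (j - 1)<..<x j})"
  have cell: "set_integrable lborel (I j) K"
    "(LBINT z:I j. K z) = h powr \<beta> / Gamma (\<beta> + 1) * L1_weight \<beta> (n - j)" if "j \<in> {1..n}" for j
  proof -
    have "x (j - 1) < x j" "x j \<le> x n" using that h by (auto simp: x)
    note I = frac_kernel_integral[OF assms(2) this]
    show "set_integrable lborel (I j) K" unfolding I_def K_def by (rule I(1))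
    have "x n - x (j - 1) = real (Suc (n - j)) * h" "x n - x j = real (n - j) * h"
      using that by (auto simp: x of_nat_diff algebra_simps)
    then have "(x n - x (j - 1)) powr \<beta> - (x n - x j) powr \<beta> = h powr \<beta> * L1_weight \<beta> (n - j)"
      unfolding L1_weight_def using h
      by (simp only: powr_mult of_nat_0_le_iff less_imp_le) (simp add: algebra_simps)
    then show "(LBINT z:I j. K z) = h powr \<beta> / Gamma (\<beta> + 1) * L1_weight \<beta> (n - j)"
      unfolding I_def K_def I(2) by simp
  qed
  have split: "indicator {a<..<x n} z * (K z * backward_diff a b P U z) =
      (\<Sum>j=1..n. (U j - U (j - 1)) * (indicator (I j) z * K z))" for z
  proof -
    have ind: "indicator {a<..<x n} z * indicator (I j) z =
        (if j \<le> n then indicator (I j) z else (0::real))" if "j \<in> {1..P}" for j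
    proof -
      have "a \<le> x (j - 1)" using x_le[of 0 "j - 1"] by (simp add: x)
      moreover have "j \<le> n \<Longrightarrow> x j \<le> x n" "\<not> j \<le> n \<Longrightarrow> x n \<le> x (j - 1)"
        by (auto simp: x_le)
      ultimately show ?thesis by (auto simp: I_def indicator_def)
    qed
    have "indicator {a<..<x n} z * (K z * backward_diff a b P U z) =
        (\<Sum>j=1..P. (U j - U (j - 1)) * K z * (indicator {a<..<x n} z * indicator (I j) z))"
      by (simp only: backward_diff_def I_def x_def sum_distrib_left mult_ac)
    also have "\<dots> = (\<Sum>j=1..P. if j \<le> n then (U j - U (j - 1)) * (indicator (I j) z * K z) else 0)"
      by (intro sum.cong refl) (simp add: ind)
    also have "\<dots> = (\<Sum>j=1..n. (U j - U (j - 1)) * (indicator (I j) z * K z))"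
      using assms(3) by (intro sum.mono_neutral_cong_right) auto
    finally show ?thesis .
  qed
  have "RL_integral a \<beta> (backward_diff a b P U) (x n) =
      (\<integral>z. (\<Sum>j=1..n. (U j - U (j - 1)) * (indicator (I j) z * K z)) \<partial>lborel)"
    using split by (simp add: RL_integral_def set_lebesgue_integral_def K_def)
  also have "\<dots> = (\<Sum>j=1..n. (U j - U (j - 1)) * (LBINT z:I j. K z))"
    using cell(1)
    by (subst Bochner_Integration.integral_sum)
       (auto simp: set_integrable_def set_lebesgue_integral_def)
  also have "\<dots> = h powr \<beta> / Gamma (\<beta> + 1) * diff_conv (L1_weight \<beta>) U n"
    by (simp add: cell(2) diff_conv_def sum_distrib_left mult_ac)
  finally show ?thesis by (simp add: x_def h_def)
qed

section \<open>Unique solvability of the scheme\<close>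

lemma mesh_mid_in_domain:
  assumes "a < b" "n < P"
  shows "mesh_mid a b P n \<in> {a<..<b}"
proof -
  define h where "h = mesh_step a b P"
  have h: "0 < h" "real P * h = b - a"
    unfolding h_def mesh_step_def using assms by auto
  have "mesh_mid a b P n = a + (real n + 1/2) * h"
    by (simp add: mesh_mid_def mesh_node_def h_def field_simps)
  moreover have "(real n + 1/2) * h < real P * h"
    using h assms(2) by (intro mult_strict_right_mono) auto
  moreover have "0 < (real n + 1/2) * h" using h by (intro mult_pos_pos) auto
  ultimately show ?thesis using h by simp
qed

theorem lemma1:
  fixes a b c0 c1 \<alpha> :: real and \<kappa> f :: "real \<Rightarrow> real" and P :: nat
  assumes "a < b" and "2 \<le> P"
    and "0 < \<alpha>" and "\<alpha> < 1"
    and "0 < c0" and "0 < c1"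
    and "\<And>x. x \<in> {a<..<b} \<Longrightarrow> c0 \<le> \<kappa> x \<and> \<kappa> x \<le> c1"
  shows "\<exists>!U. U \<in> extensional {0..P} \<and> left_fd_solution a b P \<alpha> \<kappa> f U"
proof -
  define g where "g = L1_weight (1 - \<alpha>)"
  define c where "c = mesh_step a b P powr (1 - \<alpha>) / Gamma (2 - \<alpha>)"
  define k where "k = (\<lambda>n. c * \<kappa> (mesh_mid a b P n))"
  define F where "F = (\<lambda>n. (mesh_step a b P)\<^sup>2 * f (mesh_node a b P n))"
  have "0 < mesh_step a b P" using assms(1,2) by (simp add: mesh_step_def)
  moreover have "0 < Gamma (2 - \<alpha>)" using assms(4) by (intro Gamma_real_pos) simp
  ultimately have "0 < c" by (simp add: c_def)
  then have k: "0 < k n" if "n < P" for n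
    using assms(5) assms(7)[OF mesh_mid_in_domain[OF assms(1) that]] by (simp add: k_def)
  have g: "g 0 = 1" "decseq g"
    unfolding g_def using assms(3,4) by (auto intro!: decseq_L1_weight simp: L1_weight_0)
  have P: "1 \<le> P" using assms(2) by simp
  have RL: "RL_integral a (1 - \<alpha>) (backward_diff a b P U) (mesh_node a b P n)
      = c * diff_conv g U n" if "n \<le> P" for U n
    using RL_integral_backward_diff[of a b "1 - \<alpha>" n P U] assms(1,4) that
    by (simp add: c_def g_def)
  have scheme: "left_fd_solution a b P \<alpha> \<kappa> f U \<longleftrightarrow> U 0 = 0 \<and> U P = 0 \<and>
      (\<forall>n\<in>{1..P - 1}. k (n - 1) * diff_conv g U n - k n * diff_conv g U (n + 1) = F n)" for U
  proof -
    have "\<kappa> (mesh_mid a b P (n - 1)) *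
          RL_integral a (1 - \<alpha>) (backward_diff a b P U) (mesh_node a b P n)
        - \<kappa> (mesh_mid a b P n) *
          RL_integral a (1 - \<alpha>) (backward_diff a b P U) (mesh_node a b P (n + 1))
      = k (n - 1) * diff_conv g U n - k n * diff_conv g U (n + 1)" if "n \<in> {1..P - 1}" for n
    proof -
      have "n \<le> P" "n + 1 \<le> P" using that by auto
      then show ?thesis by (simp only: RL k_def mult_ac)
    qed
    then show ?thesis unfolding left_fd_solution_def F_def by simp
  qed
  show ?thesis
  proof (rule ex_ex1I)
    have "\<exists>U. U 0 = 0 \<and> U P = 0 \<and>
        (\<forall>n\<in>{1..P - 1}. k (n - 1) * diff_conv g U n - k n * diff_conv g U (n + 1) = F n)"
      by (rule diff_conv_two_point_exists[OF g P]) (rule k)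
    then obtain U where U: "U 0 = 0" "U P = 0" "\<And>n. n \<in> {1..P - 1} \<Longrightarrow>
        k (n - 1) * diff_conv g U n - k n * diff_conv g U (n + 1) = F n"
      by blast
    \<comment> \<open>Only the nodal values up to \<open>P\<close> enter the scheme, so cutting off the rest is harmless.\<close>
    have restr: "diff_conv g (restrict U {0..P}) n = diff_conv g U n" if "n \<le> P" for n
      using that by (intro diff_conv_cong) auto
    have "k (n - 1) * diff_conv g (restrict U {0..P}) n
        - k n * diff_conv g (restrict U {0..P}) (n + 1) = F n" if "n \<in> {1..P - 1}" for n
    proof -
      have "n \<le> P" "n + 1 \<le> P" using that by auto
      then show ?thesis using U(3)[OF that] by (simp only: restr)
    qed
    then have "left_fd_solution a b P \<alpha> \<kappa> f (restrict U {0..P})"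
      unfolding scheme using U(1,2) by simp
    with restrict_extensional[of U "{0..P}"]
    show "\<exists>U. U \<in> extensional {0..P} \<and> left_fd_solution a b P \<alpha> \<kappa> f U"
      by blast
  next
    fix U V
    assume U: "U \<in> extensional {0..P} \<and> left_fd_solution a b P \<alpha> \<kappa> f U"
      and V: "V \<in> extensional {0..P} \<and> left_fd_solution a b P \<alpha> \<kappa> f V"
    from U V have sol: "left_fd_solution a b P \<alpha> \<kappa> f U" "left_fd_solution a b P \<alpha> \<kappa> f V"
      by simp_all
    \<comment> \<open>The scheme is linear, so the difference of two solutions has no source term.\<close>
    define W where "W = (\<lambda>j. U j + (-1) * V j)"
    have eq: "k (n - 1) * diff_conv g W n - k n * diff_conv g W (n + 1) = 0"
      if "n \<in> {1..P - 1}" for n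
    proof -
      have "k (n - 1) * diff_conv g U n - k n * diff_conv g U (n + 1) = F n"
        "k (n - 1) * diff_conv g V n - k n * diff_conv g V (n + 1) = F n"
        using sol[unfolded scheme] that by simp_all
      then show ?thesis unfolding W_def diff_conv_add_mult by (simp add: algebra_simps)
    qed
    have flux: "k (n - 1) * diff_conv g W n = k 0 * diff_conv g W 1" if "n \<in> {1..P}" for n
      using const_if_steps_equal[of P "\<lambda>n. k (n - 1) * diff_conv g W n" n] eq that by simp
    have "W 0 = 0" "W P = 0" using sol by (simp_all add: W_def scheme)
    then have zero: "W n = 0" if "n \<le> P" for n
      using diff_conv_two_point_unique[where k = k and U = W, OF g P _ _ _ flux that] k by blast
    show "U = V"
    proof (rule extensionalityI)
      show "U \<in> extensional {0..P}" "V \<in> extensional {0..P}" using U V by simp_all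
      show "U n = V n" if "n \<in> {0..P}" for n using zero[of n] that by (simp add: W_def)
    qed
  qed
qed

end
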